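(* Let $b_1<0<b_2$, and let $a,b,c,d\in\mathbb{C}$ be such that $bc=0$ and the boundary conditions $$y_1(0)+b\,y_2(0)+a\,y_1(1)=0,\qquad d\,y_2(0)+c\,y_1(1)+y_2(1)=0\qquad( * )$$ are regular (i.e. $ad\ne0$). (i) If $$b_1\ln|d|+b_2\ln|a|\neq0,\qquad( ** )$$ then the boundary conditions $( * )$ are strictly regular. (ii) Let $b_1/b_2\notin\mathbb{Q}$. Then condition $( ** )$ is necessary for the strict regularity of the boundary conditions $( * )$. (iii) Let $b_1/b_2\in\mathbb{Q}$ and let condition $( ** )$ be violated. Then the boundary conditions $( * )$ are strictly regular if and only if $$\frac{b_1\arg(-d)+b_2\arg(-a)}{2\pi\gcd(b_1,b_2)}\notin\mathbb{Z},$$ where $\gcd(b_1,b_2)$ is the greatest common divisor of the real numbers $b_1,b_2$, i.e. the largest number $\beta>0$ such that $b_1/\beta$ and $b_2/\beta$ are integers.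
   Context: The boundary conditions $( * )$ are imposed on solutions $y=\operatorname{col}(y_1,y_2)$ of $-iB^{-1}y'+Q(x)y=\lambda y$ on $[0,1]$, $B=\operatorname{diag}(b_1,b_2)$. They are regular if $ad-bc\neq0$. They are strictly regular if they are regular and the sequence $\{\lambda^0_n\}_{n\in\mathbb{Z}}$ of zeros, counted with multiplicity, of the characteristic determinant of the problem with $Q=0$, $$\Delta_0(\lambda)=d+a e^{i(b_1+b_2)\lambda}+(ad-bc)e^{ib_1\lambda}+e^{ib_2\lambda},$$ is asymptotically separated: there exist $\delta>0$, $n_0\in\mathbb{N}$ with $|\lambda^0_j-\lambda^0_k|>2\delta$ whenever $j\ne k$ and $|j|,|k|>n_0$ (zeros enumerated with $|\lambda_n^0|\to\infty$ as $|n|\to\infty$). *)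

theory Defs
  imports "HOL-Complex_Analysis.Complex_Analysis"
begin

text \<open>
  The equation is \<open>-i B\<^sup>-\<^sup>1 y' + Q y = \<lambda> y\<close> on \<open>[0,1]\<close> with \<open>B = diag(b1,b2)\<close>. The boundary
  conditions are \<open>bform1 a b y = 0\<close> and \<open>bform2 c d y = 0\<close>; they are represented by their
  coefficients \<open>a b c d\<close>.
\<close>

definition bform1 :: "complex \<Rightarrow> complex \<Rightarrow> (real \<Rightarrow> complex \<times> complex) \<Rightarrow> complex" where
  "bform1 a b y = fst (y 0) + b * snd (y 0) + a * fst (y 1)"

definition bform2 :: "complex \<Rightarrow> complex \<Rightarrow> (real \<Rightarrow> complex \<times> complex) \<Rightarrow> complex" where
  "bform2 c d y = d * snd (y 0) + c * fst (y 1) + snd (y 1)"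

definition char_det0 ::
  "real \<Rightarrow> real \<Rightarrow> complex \<Rightarrow> complex \<Rightarrow> complex \<Rightarrow> complex \<Rightarrow> complex \<Rightarrow> complex" where
  "char_det0 b1 b2 a b c d z =
     d + a * exp (\<i> * of_real (b1 + b2) * z)
       + (a * d - b * c) * exp (\<i> * of_real b1 * z)
       + exp (\<i> * of_real b2 * z)"

text \<open>
  For \<open>Q = 0\<close> the system decouples into \<open>y\<^sub>k' = i b\<^sub>k \<lambda> y\<^sub>k\<close>. The explicit formula above is the
  determinant of the boundary forms on the resulting fundamental system.
\<close>

lemma char_det0_eq_det:
  defines "e1 \<equiv> \<lambda>b1 z x. (exp (\<i> * of_real b1 * z * of_real x), 0)"
    and "e2 \<equiv> \<lambda>b2 z x. (0, exp (\<i> * of_real b2 * z * of_real x))"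
  shows "char_det0 b1 b2 a b c d z =
    bform1 a b (e1 b1 z) * bform2 c d (e2 b2 z) - bform1 a b (e2 b2 z) * bform2 c d (e1 b1 z)"
  by (simp add: char_det0_def bform1_def bform2_def e1_def e2_def algebra_simps exp_add)

definition regular_bc :: "complex \<Rightarrow> complex \<Rightarrow> complex \<Rightarrow> complex \<Rightarrow> bool" where
  "regular_bc a b c d \<longleftrightarrow> a * d - b * c \<noteq> 0"

text \<open>
  A two-sided sequence of the zeros of \<open>f\<close>, each repeated according to its multiplicity (which
  is \<open>zorder f z\<close> for an entire \<open>f\<close> that is not identically zero), with \<open>\<bar>l n\<bar> \<rightarrow> \<infinity>\<close> as
  \<open>\<bar>n\<bar> \<rightarrow> \<infinity>\<close>.
\<close>

definition zero_enumeration :: "(complex \<Rightarrow> complex) \<Rightarrow> (int \<Rightarrow> complex) \<Rightarrow> bool" where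
  "zero_enumeration f l \<longleftrightarrow>
     range l = {z. f z = 0} \<and>
     (\<forall>z. f z = 0 \<longrightarrow> finite {n. l n = z} \<and> int (card {n. l n = z}) = zorder f z) \<and>
     filterlim l at_infinity (filtercomap (\<lambda>n. \<bar>n\<bar>) at_top)"

definition asymptotically_separated :: "(int \<Rightarrow> complex) \<Rightarrow> bool" where
  "asymptotically_separated l \<longleftrightarrow>
     (\<exists>\<delta>>0. \<exists>n0::nat. \<forall>j k. j \<noteq> k \<and> \<bar>j\<bar> > int n0 \<and> \<bar>k\<bar> > int n0 \<longrightarrow> cmod (l j - l k) > 2 * \<delta>)"

text \<open>
  Any two enumerations of the same zeros differ by a permutation of \<open>\<int>\<close>, under which asymptotic
  separation is invariant. The existential quantifier therefore only fixes some enumeration.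
\<close>

definition strictly_regular_bc ::
  "real \<Rightarrow> real \<Rightarrow> complex \<Rightarrow> complex \<Rightarrow> complex \<Rightarrow> complex \<Rightarrow> bool" where
  "strictly_regular_bc b1 b2 a b c d \<longleftrightarrow>
     regular_bc a b c d \<and>
     (\<exists>l. zero_enumeration (char_det0 b1 b2 a b c d) l \<and> asymptotically_separated l)"

definition real_gcd :: "real \<Rightarrow> real \<Rightarrow> real" where
  "real_gcd x y = (GREATEST \<beta>. \<beta> > 0 \<and> x / \<beta> \<in> \<int> \<and> y / \<beta> \<in> \<int>)"

end

theory Submission imports Defs begin

text \<open>
  For \<open>b c = 0\<close> the characteristic determinant factors as
  \<open>(1 + a e\<^bsup>i b1 z\<^esup>) (d + e\<^bsup>i b2 z\<^esup>)\<close>, so its zeros are the union of the two arithmetic progressions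
  \<open>p n = u1 + 2 \<pi> n / b1\<close> and \<open>q m = u2 + 2 \<pi> m / b2\<close>, each consisting of simple zeros of its
  factor. A positive lower bound for the distances \<open>\<bar>p n - q m\<bar>\<close> makes the zeros
  asymptotically separated; conversely, asymptotic separation gives such a bound for all but
  finitely many \<open>n\<close>, a common value of \<open>p\<close> and \<open>q\<close> being a double zero.
  The imaginary part of \<open>p n - q m\<close> is constant and vanishes exactly if \<open>(**)\<close> fails. In that case
  the real part comes arbitrarily close to \<open>0\<close> when \<open>b1 / b2\<close> is irrational (Kronecker), and
  ranges over a shifted lattice when \<open>b1 / b2\<close> is rational.
\<close>

section \<open>Enumerations of zeros\<close>

text \<open>A set of integers is finite exactly if it is bounded in absolute value. This turns
  divergence of an enumeration into finiteness of index sets, which is easy to combine under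
  unions.\<close>

lemma filtercomap_abs_at_top_int: "filtercomap (\<lambda>n::int. \<bar>n\<bar>) at_top = cofinite"
proof (rule filter_eqI)
  fix P :: "int \<Rightarrow> bool"
  have "eventually P (filtercomap (\<lambda>n. \<bar>n\<bar>) at_top) \<longleftrightarrow> (\<exists>N. \<forall>n. \<bar>n\<bar> \<ge> N \<longrightarrow> P n)"
    by (simp add: eventually_filtercomap_at_top_linorder)
  also have "\<dots> \<longleftrightarrow> finite {n. \<not> P n}"
    using infinite_int_iff_unbounded_le[of "{n. \<not> P n}"] by auto
  finally show "eventually P (filtercomap (\<lambda>n. \<bar>n\<bar>) at_top) \<longleftrightarrow> eventually P cofinite"
    by (simp add: eventually_cofinite)
qed

lemma filterlim_at_infinity_int_iff:
  fixes l :: "int \<Rightarrow> 'a::real_normed_vector"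
  shows "filterlim l at_infinity (filtercomap (\<lambda>n. \<bar>n\<bar>) at_top) \<longleftrightarrow>
    (\<forall>r. finite {n. norm (l n) \<le> r})"
proof -
  have "filterlim l at_infinity cofinite \<longleftrightarrow> (\<forall>r. finite {n. norm (l n) \<le> r})"
  proof
    assume "filterlim l at_infinity cofinite"
    \<comment> \<open>The bound \<open>\<bar>r\<bar> + 1\<close> is positive, as
      \<open>filterlim_at_infinity\<close> demands, and strictly above \<open>r\<close>, so that
      \<open>norm (l n) \<le> r\<close> contradicts it.\<close>
    then have "eventually (\<lambda>n. norm (l n) \<ge> \<bar>r\<bar> + 1) cofinite" for r
      using filterlim_at_infinity[of 0 l cofinite] by auto
    then have "finite {n. \<not> norm (l n) \<ge> \<bar>r\<bar> + 1}" for r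
      by (simp add: eventually_cofinite)
    moreover have "{n. norm (l n) \<le> r} \<subseteq> {n. \<not> norm (l n) \<ge> \<bar>r\<bar> + 1}" for r
      by auto
    ultimately show "\<forall>r. finite {n. norm (l n) \<le> r}"
      by (meson finite_subset)
  next
    assume *: "\<forall>r. finite {n. norm (l n) \<le> r}"
    have "finite {n. \<not> r \<le> norm (l n)}" for r
      by (rule finite_subset[OF _ *[rule_format, of r]]) auto
    then show "filterlim l at_infinity cofinite"
      by (simp add: filterlim_at_infinity[of 0] eventually_cofinite)
  qed
  then show ?thesis by (simp add: filtercomap_abs_at_top_int)
qed

lemma zero_enumeration_finite_ball:
  assumes "zero_enumeration f l"
  shows "finite {n. cmod (l n - w) < r}"
proof (rule finite_subset)
  show "finite {n. cmod (l n) \<le> cmod w + r}"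
    using assms unfolding zero_enumeration_def filterlim_at_infinity_int_iff by blast
  show "{n. cmod (l n - w) < r} \<subseteq> {n. cmod (l n) \<le> cmod w + r}"
    using norm_triangle_sub[of _ w] by (smt (verit) Collect_mono)
qed

text \<open>Only finitely many indices land in a unit ball, so the zeros cannot accumulate. The
  additivity of \<open>zorder\<close> over products relies on this.\<close>

lemma zero_enumeration_eventually_nonzero:
  assumes "zero_enumeration f l"
  shows "eventually (\<lambda>w. f w \<noteq> 0) (at z)"
proof -
  have "{w. f w = 0} \<inter> ball z 1 \<subseteq> l ` {n. cmod (l n - z) < 1}"
    using assms by (force simp: zero_enumeration_def dist_norm norm_minus_commute)
  then have "finite ({w. f w = 0} \<inter> ball z 1)"
    using zero_enumeration_finite_ball[OF assms] by (meson finite_imageI finite_subset)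
  then have "\<not> z islimpt ({w. f w = 0} \<inter> ball z 1)"
    by (rule islimpt_finite)
  then have "eventually (\<lambda>w. w \<notin> {w. f w = 0} \<inter> ball z 1) (at z)"
    by (simp add: islimpt_iff_eventually)
  moreover have "eventually (\<lambda>w. w \<in> ball z 1) (at z)"
    by (rule eventually_at_in_open') auto
  ultimately show ?thesis
    by eventually_elim auto
qed

lemma zero_enumeration_zorder_times:
  assumes "g analytic_on UNIV" "h analytic_on UNIV"
    and "zero_enumeration g p" "zero_enumeration h q"
  shows "zorder (\<lambda>z. g z * h z) z = zorder g z + zorder h z"
proof (rule zorder_times_analytic)
  show "eventually (\<lambda>z. g z * h z \<noteq> 0) (at z)"
    using zero_enumeration_eventually_nonzero[OF assms(3)]
      zero_enumeration_eventually_nonzero[OF assms(4)]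
    by eventually_elim simp
qed (use assms analytic_on_subset in blast)+

text \<open>At a point that is not a zero, both the count and the order are 0. Covering such points
  spares case distinctions when only one factor of a product vanishes.\<close>

lemma zero_enumeration_card:
  assumes "f analytic_on UNIV" "zero_enumeration f l"
  shows "finite {n. l n = z}" "int (card {n. l n = z}) = zorder f z"
proof -
  have "finite {n. l n = z} \<and> int (card {n. l n = z}) = zorder f z"
  proof (cases "f z = 0")
    case True
    then show ?thesis using assms(2) by (simp add: zero_enumeration_def)
  next
    case False
    then have "{n. l n = z} = {}"
      using assms(2) by (auto simp: zero_enumeration_def)
    moreover have "zorder f z = 0"
      using False assms(1) analytic_on_subset by (intro zorder_eq_0I) auto
    ultimately show ?thesis by simp
  qed
  then show "finite {n. l n = z}" "int (card {n. l n = z}) = zorder f z" by auto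
qed

section \<open>Zeros of a product and their separation\<close>

definition interleave :: "(int \<Rightarrow> 'a) \<Rightarrow> (int \<Rightarrow> 'a) \<Rightarrow> int \<Rightarrow> 'a" where
  "interleave p q n = (if even n then p (n div 2) else q (n div 2))"

lemma interleave_double [simp]:
  "interleave p q (2 * k) = p k" "interleave p q (2 * k + 1) = q k"
  by (auto simp: interleave_def)

lemma Collect_interleave:
  "{n. R (interleave p q n)} = (\<lambda>k. 2 * k) ` {k. R (p k)} \<union> (\<lambda>k. 2 * k + 1) ` {k. R (q k)}"
proof (intro set_eqI iffI)
  fix n assume "n \<in> {n. R (interleave p q n)}"
  then show "n \<in> (\<lambda>k. 2 * k) ` {k. R (p k)} \<union> (\<lambda>k. 2 * k + 1) ` {k. R (q k)}"
    by (cases "even n") (auto elim!: evenE oddE)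
qed auto

text \<open>The indices of a given zero split into an even copy of those from \<open>p\<close> and
  an odd copy of those from \<open>q\<close>, so the counts add just as the orders do.\<close>

lemma zero_enumeration_times:
  assumes "g analytic_on UNIV" "h analytic_on UNIV"
    and "zero_enumeration g p" "zero_enumeration h q"
  shows "zero_enumeration (\<lambda>z. g z * h z) (interleave p q)"
  unfolding zero_enumeration_def filterlim_at_infinity_int_iff
proof (intro conjI allI impI)
  have "range (interleave p q) = range p \<union> range q"
  proof (intro equalityI subsetI)
    fix w assume "w \<in> range p \<union> range q"
    then obtain k where "w = interleave p q (2 * k) \<or> w = interleave p q (2 * k + 1)"
      by auto
    then show "w \<in> range (interleave p q)" by blast
  qed (auto simp: interleave_def)
  then show "range (interleave p q) = {z. g z * h z = 0}"
    using assms(3,4) by (auto simp: zero_enumeration_def)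
next
  fix z
  note g = zero_enumeration_card[OF assms(1,3), of z]
  note h = zero_enumeration_card[OF assms(2,4), of z]
  note preimage = Collect_interleave[of "\<lambda>w. w = z" p q]
  show "finite {n. interleave p q n = z}"
    unfolding preimage using g h by simp
  have "card {n. interleave p q n = z} =
      card ((\<lambda>k. 2 * k) ` {k. p k = z}) + card ((\<lambda>k. 2 * k + 1) ` {k. q k = z})"
    unfolding preimage using g h
    by (intro card_Un_disjoint) (auto, presburger)
  also have "\<dots> = card {k. p k = z} + card {k. q k = z}"
    by (simp add: card_image inj_on_def)
  finally show "int (card {n. interleave p q n = z}) = zorder (\<lambda>z. g z * h z) z"
    using g h zero_enumeration_zorder_times[OF assms] by simp
next
  fix r
  show "finite {n. cmod (interleave p q n) \<le> r}"
    using assms(3,4) unfolding Collect_interleave[of "\<lambda>w. cmod w \<le> r" p q]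
    by (simp add: zero_enumeration_def filterlim_at_infinity_int_iff)
qed

text \<open>Different values have different indices. A common value is a zero of the product of
  order at least 2, so \<open>l\<close> takes it at two indices.\<close>

lemma zero_enumeration_times_index_pair:
  assumes "g analytic_on UNIV" "h analytic_on UNIV"
    and "zero_enumeration g p" "zero_enumeration h q"
    and "zero_enumeration (\<lambda>z. g z * h z) l"
  shows "\<exists>j k. j \<noteq> k \<and> l j = p n \<and> l k = q m"
proof (cases "p n = q m")
  case False
  have "p n \<in> range l" "q m \<in> range l"
    using assms(3,4,5) by (auto simp: zero_enumeration_def)
  with False show ?thesis by (metis rangeE)
next
  case True
  let ?z = "p n" and ?S = "{j. l j = p n}"
  note g = zero_enumeration_card[OF assms(1,3), of ?z]
  note h = zero_enumeration_card[OF assms(2,4), of ?z]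
  have gh: "(\<lambda>z. g z * h z) analytic_on UNIV"
    using assms(1,2) by (intro analytic_intros)
  have "card {k. p k = ?z} > 0" "card {k. q k = ?z} > 0"
    using g(1) h(1) True by (auto simp: card_gt_0_iff)
  then have "card ?S \<ge> 2"
    using g(2) h(2) zero_enumeration_card(2)[OF gh assms(5), of ?z]
      zero_enumeration_zorder_times[OF assms(1-4), of ?z] by linarith
  then obtain T where "T \<subseteq> ?S" "card T = 2"
    by (meson obtain_subset_with_card_n)
  then obtain j k where "j \<noteq> k" "j \<in> ?S" "k \<in> ?S"
    by (auto simp: card_2_iff)
  then show ?thesis using True by auto
qed

text \<open>If \<open>p n\<close> and \<open>q m\<close> are closer than the separation constant,
  one of their indices in \<open>l\<close> lies in the exceptional range, so one of the two values
  lies in a finite set \<open>V\<close>. Each value of \<open>V\<close> is some \<open>p n\<close>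
  for finitely many \<open>n\<close> only. It is some \<open>q m\<close> for finitely many
  \<open>m\<close> only, and each such \<open>q m\<close> has finitely many \<open>p n\<close> near
  it.\<close>

lemma asymptotically_separated_times_imp:
  assumes "g analytic_on UNIV" "h analytic_on UNIV"
    and "zero_enumeration g p" "zero_enumeration h q"
    and "zero_enumeration (\<lambda>z. g z * h z) l" "asymptotically_separated l"
  shows "\<exists>\<delta>>0. finite {n. \<exists>m. cmod (p n - q m) < \<delta>}"
proof -
  obtain \<delta> n0 where "\<delta> > 0" and
    sep: "\<And>j k. j \<noteq> k \<Longrightarrow> \<bar>j\<bar> > int n0 \<Longrightarrow> \<bar>k\<bar> > int n0 \<Longrightarrow> cmod (l j - l k) > 2 * \<delta>"
    using assms(6) unfolding asymptotically_separated_def by blast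
  define V where "V = l ` {- int n0..int n0}"
  have "finite V" by (simp add: V_def)
  have fin_p: "finite {n. p n = v}" and fin_q: "finite {n. q n = v}" for v
    using zero_enumeration_card assms by blast+
  define M where "M = (\<Union>v\<in>V. {m. q m = v})"
  have "finite M" using \<open>finite V\<close> fin_q by (simp add: M_def)
  have "{n. \<exists>m. cmod (p n - q m) < \<delta>} \<subseteq>
      (\<Union>v\<in>V. {n. p n = v}) \<union> (\<Union>m\<in>M. {n. cmod (p n - q m) < \<delta>})"
  proof
    fix n assume "n \<in> {n. \<exists>m. cmod (p n - q m) < \<delta>}"
    then obtain m where m: "cmod (p n - q m) < \<delta>" by blast
    obtain j k where jk: "j \<noteq> k" "l j = p n" "l k = q m"
      using zero_enumeration_times_index_pair[OF assms(1-5)] by blast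
    have "\<bar>j\<bar> \<le> int n0 \<or> \<bar>k\<bar> \<le> int n0"
      using sep[OF jk(1)] jk m \<open>\<delta> > 0\<close> by force
    then have "p n \<in> V \<or> q m \<in> V"
      unfolding V_def using jk by (smt (verit) atLeastAtMost_iff imageI)
    then show "n \<in> (\<Union>v\<in>V. {n. p n = v}) \<union> (\<Union>m\<in>M. {n. cmod (p n - q m) < \<delta>})"
      using m by (auto simp: M_def)
  qed
  moreover have "finite \<dots>"
    using \<open>finite V\<close> \<open>finite M\<close> fin_p zero_enumeration_finite_ball[OF assms(3)] by blast
  ultimately show ?thesis using \<open>\<delta> > 0\<close> finite_subset by blast
qed

lemma asymptotically_separated_interleave:
  assumes "\<epsilon> > 0"
    and p: "\<And>n m. n \<noteq> m \<Longrightarrow> cmod (p n - p m) \<ge> \<epsilon>"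
    and q: "\<And>n m. n \<noteq> m \<Longrightarrow> cmod (q n - q m) \<ge> \<epsilon>"
    and pq: "\<And>n m. cmod (p n - q m) \<ge> \<epsilon>"
  shows "asymptotically_separated (interleave p q)"
proof -
  have *: "cmod (interleave p q j - interleave p q k) \<ge> \<epsilon>" if "j \<noteq> k" for j k
  proof -
    obtain j' k' where "j = 2 * j' \<or> j = 2 * j' + 1" "k = 2 * k' \<or> k = 2 * k' + 1"
      by (metis evenE oddE)
    then show ?thesis
      using that p q pq pq[of k' j', unfolded norm_minus_commute[of "p k'"]] by auto
  qed
  show ?thesis
    unfolding asymptotically_separated_def
    \<comment> \<open>The separation required is strict, so twice the constant must stay below
      \<open>\<epsilon>\<close>. No indices need excluding.\<close>
    using \<open>\<epsilon> > 0\<close> * by (intro exI[of _ "\<epsilon> / 3"] conjI exI[of _ 0] allI impI) (auto, force)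
qed

section \<open>Arithmetic progressions as zero sets of exponentials\<close>

lemma arith_progression_separated:
  fixes u :: complex and t :: real
  assumes "n \<noteq> m"
  shows "cmod ((u + of_real (t * of_int n)) - (u + of_real (t * of_int m))) \<ge> \<bar>t\<bar>"
proof -
  have "(u + of_real (t * of_int n)) - (u + of_real (t * of_int m)) =
      complex_of_real (t * of_int (n - m))"
    by (simp add: algebra_simps)
  moreover have "\<bar>real_of_int (n - m)\<bar> \<ge> 1"
    using assms by linarith
  ultimately show ?thesis
    using mult_left_mono[of 1 "\<bar>real_of_int (n - m)\<bar>" "\<bar>t\<bar>"]
    by (simp only: norm_of_real abs_mult mult_1_right abs_ge_zero)
qed

lemma finite_arith_progression_le:
  fixes u :: complex and t :: real
  assumes "t \<noteq> 0"
  shows "finite {n::int. cmod (u + of_real (t * of_int n)) \<le> r}"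
proof -
  define N where "N = \<lceil>(r + cmod u) / \<bar>t\<bar>\<rceil>"
  have "{n::int. cmod (u + of_real (t * of_int n)) \<le> r} \<subseteq> {- N..N}"
  proof
    fix n :: int assume "n \<in> {n. cmod (u + of_real (t * of_int n)) \<le> r}"
    then have "cmod (of_real (t * of_int n)) \<le> r + cmod u"
      using norm_triangle_ineq4[of "u + of_real (t * of_int n)" u] by simp
    then have "\<bar>real_of_int n\<bar> \<le> (r + cmod u) / \<bar>t\<bar>"
      unfolding norm_of_real using assms by (simp add: abs_mult field_simps)
    then have "\<bar>n\<bar> \<le> N"
      unfolding N_def by linarith
    then show "n \<in> {- N..N}" by auto
  qed
  then show ?thesis by (rule finite_subset) simp
qed

text \<open>The zeros come from the period of \<open>exp\<close>. They are simple because the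
  derivative, a nonzero multiple of an exponential, never vanishes. One reference zero
  \<open>u\<close> and a factor \<open>k\<close> let both factors of the determinant fit this
  form.\<close>

lemma zero_enumeration_exp:
  fixes b :: real and k u :: complex
  assumes "b \<noteq> 0" "k \<noteq> 0"
  shows "zero_enumeration (\<lambda>z. k * (exp (\<i> * of_real b * z) - exp (\<i> * of_real b * u)))
    (\<lambda>n. u + of_real (2 * pi / b * of_int n))"
    (is "zero_enumeration ?f ?l")
  unfolding zero_enumeration_def filterlim_at_infinity_int_iff
proof (intro conjI allI impI)
  have "?f z = 0 \<longleftrightarrow> (\<exists>n. z = ?l n)" for z
  proof -
    have "?f z = 0 \<longleftrightarrow> (\<exists>n::int. \<i> * of_real b * z = \<i> * of_real b * u + (of_int (2 * n) * pi) * \<i>)"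
      using assms by (simp add: exp_eq)
    also have "\<dots> \<longleftrightarrow> (\<exists>n. z = ?l n)"
    proof (rule ex_cong1)
      fix n
      have "\<i> * of_real b * z = \<i> * of_real b * u + (of_int (2 * n) * pi) * \<i> \<longleftrightarrow>
          \<i> * of_real b * z = \<i> * of_real b * ?l n"
        using assms by (simp add: distrib_left mult_ac)
      then show "\<i> * of_real b * z = \<i> * of_real b * u + (of_int (2 * n) * pi) * \<i> \<longleftrightarrow> z = ?l n"
        using assms by simp
    qed
    finally show ?thesis .
  qed
  then show range: "range ?l = {z. ?f z = 0}" by auto
  fix z assume z: "?f z = 0"
  then obtain n where n: "z = ?l n" using range by blast
  have "{m. ?l m = z} = {n}"
    using assms n by auto
  moreover have "zorder ?f z = 1"
  proof (rule zorder_zero_eqI')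
    have "(?f has_field_derivative k * (exp (\<i> * of_real b * z) * (\<i> * of_real b))) (at z)"
      by (auto intro!: derivative_eq_intros)
    then show "(deriv ^^ nat 1) ?f z \<noteq> 0"
      using assms by (simp add: DERIV_imp_deriv)
    show "?f analytic_on {z}" by (intro analytic_intros)
  qed (use z in auto)
  ultimately show "finite {m. ?l m = z}" "int (card {m. ?l m = z}) = zorder ?f z"
    by simp_all
next
  show "finite {n. cmod (?l n) \<le> r}" for r
    using assms by (intro finite_arith_progression_le) simp
qed

section \<open>Rational approximation\<close>

text \<open>If \<open>x / y = k / l\<close> in lowest terms, the greatest common divisor is
  \<open>y / l\<close>: for any common divisor \<open>\<gamma>\<close>, coprimality forces
  \<open>l\<close> to divide \<open>y / \<gamma>\<close>, whence
  \<open>\<gamma> \<le> y / l\<close>.\<close>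

lemma real_gcd_rational:
  fixes x y :: real
  assumes "x \<noteq> 0" "y > 0" "x / y \<in> \<rat>"
  obtains k l :: int where "coprime k l" "k \<noteq> 0" "real_gcd x y > 0"
    "x = of_int k * real_gcd x y" "y = of_int l * real_gcd x y"
proof -
  obtain k l :: int where l: "l > 0" and cop: "coprime k l" and xy: "x / y = of_int k / of_int l"
    using assms(3) by (rule Rats_cases')
  define \<beta> where "\<beta> = y / of_int l"
  have "\<beta> > 0" using l assms by (simp add: \<beta>_def)
  have y: "y = of_int l * \<beta>" using l by (simp add: \<beta>_def)
  have x: "x = of_int k * \<beta>" using xy l assms by (simp add: \<beta>_def field_simps)
  have "k \<noteq> 0" using x assms by auto
  have "real_gcd x y = \<beta>"
    unfolding real_gcd_def
  proof (rule Greatest_equality)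
    show "\<beta> > 0 \<and> x / \<beta> \<in> \<int> \<and> y / \<beta> \<in> \<int>"
      using \<open>\<beta> > 0\<close> x y by auto
  next
    fix \<gamma> :: real assume \<gamma>: "\<gamma> > 0 \<and> x / \<gamma> \<in> \<int> \<and> y / \<gamma> \<in> \<int>"
    then obtain i j :: int where ij: "x / \<gamma> = of_int i" "y / \<gamma> = of_int j"
      by (auto elim!: Ints_cases)
    then have xi: "x = of_int i * \<gamma>" and yj: "y = of_int j * \<gamma>"
      using \<gamma> by (auto simp: field_simps)
    have "j > 0"
      using yj \<gamma> assms(2) by (simp add: zero_less_mult_iff)
    have "real_of_int (i * l) = of_int (k * j)"
      using xy xi yj \<gamma> l \<open>j > 0\<close> by (simp add: field_simps)
    then have "i * l = k * j" by linarith
    then have "l dvd j"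
      using cop by (metis coprime_commute coprime_dvd_mult_right_iff dvd_triv_right)
    then have "l \<le> j" using \<open>j > 0\<close> by (rule zdvd_imp_le)
    then have "real_of_int l * \<gamma> \<le> of_int j * \<gamma>" using \<gamma> by (intro mult_right_mono) auto
    also have "\<dots> = of_int l * \<beta>" using y yj by simp
    finally show "\<gamma> \<le> \<beta>" using l by simp
  qed
  then show thesis using that cop \<open>k \<noteq> 0\<close> \<open>\<beta> > 0\<close> x y by blast
qed

lemma infinite_inhomogeneous_approx:
  fixes \<theta> :: real
  assumes "\<theta> \<notin> \<rat>" "\<epsilon> > 0"
  shows "infinite {n::int. \<exists>m::int. \<bar>of_int n * \<theta> - of_int m - \<alpha>\<bar> < \<epsilon>}"
  unfolding infinite_int_iff_unbounded
proof
  fix N :: int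
  \<comment> \<open>Density yields a single positive \<open>k\<close>. Applying it to the target
    shifted by \<open>\<bar>N\<bar> * \<theta>\<close> gives an index
    \<open>k + \<bar>N\<bar>\<close> beyond \<open>N\<close> for the original target.\<close>
  obtain h k where hk: "k > 0" "\<bar>of_int k * \<theta> - of_int h - (\<alpha> - of_int \<bar>N\<bar> * \<theta>)\<bar> < \<epsilon>"
    using sequence_of_fractional_parts_is_dense[OF assms] by blast
  then have "\<bar>of_int (k + \<bar>N\<bar>) * \<theta> - of_int h - \<alpha>\<bar> < \<epsilon>"
    by (simp add: algebra_simps)
  moreover have "\<bar>k + \<bar>N\<bar>\<bar> > N" using hk by linarith
  ultimately show "\<exists>n. \<bar>n\<bar> > N \<and> n \<in> {n. \<exists>m. \<bar>of_int n * \<theta> - of_int m - \<alpha>\<bar> < \<epsilon>}"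
    by blast
qed

text \<open>The integers closest to \<open>x\<close> on either side are at distances
  \<open>frac x\<close> and \<open>1 - frac x\<close>, both positive.\<close>

lemma distance_to_Ints_bounded_below:
  fixes x :: real
  assumes "x \<notin> \<int>"
  obtains \<epsilon> where "\<epsilon> > 0" "\<And>k::int. \<bar>of_int k - x\<bar> \<ge> \<epsilon>"
proof -
  have "frac x > 0" using assms by (simp add: frac_gt_0_iff)
  moreover have "frac x < 1" by (rule frac_lt_1)
  moreover have "\<bar>of_int k - x\<bar> \<ge> min (frac x) (1 - frac x)" for k :: int
  proof (cases "k \<le> \<lfloor>x\<rfloor>")
    case True
    then have "real_of_int k \<le> of_int \<lfloor>x\<rfloor>" by simp
    then show ?thesis unfolding frac_def by linarith
  next
    case False
    then have "real_of_int k \<ge> of_int \<lfloor>x\<rfloor> + 1" by linarith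
    then show ?thesis unfolding frac_def by linarith
  qed
  ultimately show thesis using that[of "min (frac x) (1 - frac x)"] by simp
qed

section \<open>Separation of the two progressions\<close>

context
  fixes b1 b2 :: real and a d :: complex
  assumes b1: "b1 < 0" and b2: "0 < b2" and a: "a \<noteq> 0" and d: "d \<noteq> 0"
begin

text \<open>
  The first factor vanishes where \<open>e\<^bsup>i b1 z\<^esup> = - 1 / a\<close>. Writing the logarithm as \<open>- Ln (- a)\<close>
  rather than \<open>Ln (- 1 / a)\<close> avoids a case distinction at the branch cut.
\<close>

definition zero1 :: "int \<Rightarrow> complex" where
  "zero1 n = \<i> * Ln (- a) / of_real b1 + of_real (2 * pi / b1 * of_int n)"

definition zero2 :: "int \<Rightarrow> complex" where
  "zero2 m = - \<i> * Ln (- d) / of_real b2 + of_real (2 * pi / b2 * of_int m)"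

text \<open>The factor \<open>\<i>\<close> sends the logarithms of the moduli to the imaginary part,
  which is free of \<open>n\<close> and \<open>m\<close>, and the arguments to the real part. Over
  the common denominator \<open>b1 * b2\<close> the numerators contain exactly the two quantities of
  the theorem.\<close>

lemma zero1_minus_zero2:
  "zero1 n - zero2 m =
     Complex (2 * pi * (b2 * of_int n - b1 * of_int m) - (b1 * Arg (- d) + b2 * Arg (- a)))
       (b1 * ln (cmod d) + b2 * ln (cmod a)) / of_real (b1 * b2)"
proof -
  have Ln: "Ln (- a) = Complex (ln (cmod a)) (Arg (- a))"
    "Ln (- d) = Complex (ln (cmod d)) (Arg (- d))"
    using a d by (auto simp: complex_eq_iff Arg_eq_Im_Ln)
  show ?thesis
    unfolding zero1_def zero2_def Ln using b1 b2
    by (auto simp: complex_eq_iff Re_divide Im_divide power2_eq_square field_simps)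
qed

lemma zero_enumerations:
  obtains g h where "g analytic_on UNIV" "h analytic_on UNIV"
    "zero_enumeration g zero1" "zero_enumeration h zero2"
    "\<And>b c. b * c = 0 \<Longrightarrow> char_det0 b1 b2 a b c d = (\<lambda>z. g z * h z)"
proof -
  define u1 where "u1 = \<i> * Ln (- a) / of_real b1"
  define u2 where "u2 = - \<i> * Ln (- d) / of_real b2"
  \<comment> \<open>With the values \<open>e1\<close> and \<open>e2\<close> below, these are
    \<open>1 + a * exp (\<i> * b1 * z)\<close> and \<open>d + exp (\<i> * b2 * z)\<close>, written
    in the form of \<open>zero_enumeration_exp\<close>.\<close>
  define g where "g = (\<lambda>z. a * (exp (\<i> * of_real b1 * z) - exp (\<i> * of_real b1 * u1)))"
  define h where "h = (\<lambda>z. 1 * (exp (\<i> * of_real b2 * z) - exp (\<i> * of_real b2 * u2)))"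
  have "\<i> * of_real b1 * u1 = - Ln (- a)"
    using b1 by (simp add: u1_def field_simps)
  then have e1: "exp (\<i> * of_real b1 * u1) = - (1 / a)"
    using a by (simp add: exp_minus field_simps)
  have "\<i> * of_real b2 * u2 = Ln (- d)"
    using b2 by (simp add: u2_def field_simps)
  then have e2: "exp (\<i> * of_real b2 * u2) = - d"
    using d by simp
  show thesis
  proof
    show "g analytic_on UNIV" "h analytic_on UNIV"
      unfolding g_def h_def by (auto intro!: analytic_intros)
    show "zero_enumeration g zero1"
      unfolding g_def zero1_def using zero_enumeration_exp[of b1 a u1] a b1
      by (simp add: u1_def zero1_def)
    show "zero_enumeration h zero2"
      unfolding h_def zero2_def using zero_enumeration_exp[of b2 1 u2] b2
      by (simp add: u2_def zero2_def)
    show "char_det0 b1 b2 a b c d = (\<lambda>z. g z * h z)" if "b * c = 0" for b c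
      unfolding char_det0_def g_def h_def e1 e2 that using a
      by (auto simp: fun_eq_iff field_simps exp_add)
  qed
qed

section \<open>Strict regularity and distances between the progressions\<close>

lemma strictly_regular_bcI:
  assumes "b * c = 0" "\<epsilon> > 0" and sep: "\<And>n m. cmod (zero1 n - zero2 m) \<ge> \<epsilon>"
  shows "strictly_regular_bc b1 b2 a b c d"
proof -
  \<comment> \<open>Distances within a progression are at least its step length, distances across at
    least \<open>\<epsilon>\<close>.\<close>
  define \<eta> where "\<eta> = min \<epsilon> (min \<bar>2 * pi / b1\<bar> \<bar>2 * pi / b2\<bar>)"
  have "asymptotically_separated (interleave zero1 zero2)"
  proof (rule asymptotically_separated_interleave)
    show "\<eta> > 0" using assms(2) b1 b2 by (simp add: \<eta>_def divide_neg_neg divide_pos_neg less_imp_neq)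
    show "cmod (zero1 n - zero1 m) \<ge> \<eta>" if "n \<noteq> m" for n m
      unfolding zero1_def
      by (rule order_trans[OF _ arith_progression_separated[OF that]]) (simp add: \<eta>_def)
    show "cmod (zero2 n - zero2 m) \<ge> \<eta>" if "n \<noteq> m" for n m
      unfolding zero2_def
      by (rule order_trans[OF _ arith_progression_separated[OF that]]) (simp add: \<eta>_def)
    show "cmod (zero1 n - zero2 m) \<ge> \<eta>" for n m
      using sep[of n m] by (simp add: \<eta>_def)
  qed
  moreover have "zero_enumeration (char_det0 b1 b2 a b c d) (interleave zero1 zero2)"
    using zero_enumerations zero_enumeration_times assms(1) by metis
  ultimately show ?thesis
    using a d assms(1) unfolding strictly_regular_bc_def regular_bc_def by auto
qed

lemma strictly_regular_bcD:
  assumes "b * c = 0" "strictly_regular_bc b1 b2 a b c d"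
  obtains \<delta> where "\<delta> > 0" "finite {n. \<exists>m. cmod (zero1 n - zero2 m) < \<delta>}"
proof -
  obtain g h where gh: "g analytic_on UNIV" "h analytic_on UNIV"
    "zero_enumeration g zero1" "zero_enumeration h zero2"
    "char_det0 b1 b2 a b c d = (\<lambda>z. g z * h z)"
    using zero_enumerations assms(1) by metis
  obtain l where "zero_enumeration (\<lambda>z. g z * h z) l" "asymptotically_separated l"
    using assms(2) gh(5) unfolding strictly_regular_bc_def by auto
  then show thesis
    using asymptotically_separated_times_imp[OF gh(1-4)] that by blast
qed

text \<open>The progressions lie on two distinct horizontal lines, whose distance is the required
  bound.\<close>

lemma strictly_regular_bc_if_ln_neq_0:
  assumes "b * c = 0" "b1 * ln (cmod d) + b2 * ln (cmod a) \<noteq> 0"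
  shows "strictly_regular_bc b1 b2 a b c d"
proof (rule strictly_regular_bcI[OF assms(1)])
  let ?L = "b1 * ln (cmod d) + b2 * ln (cmod a)"
  show "\<bar>?L\<bar> / \<bar>b1 * b2\<bar> > 0" using assms(2) b1 b2 by simp
  show "cmod (zero1 n - zero2 m) \<ge> \<bar>?L\<bar> / \<bar>b1 * b2\<bar>" for n m
    unfolding zero1_minus_zero2 norm_divide norm_of_real
    by (intro divide_right_mono order_trans[OF _ abs_Im_le_cmod]) auto
qed

lemma norm_zero1_minus_zero2:
  assumes "b1 * ln (cmod d) + b2 * ln (cmod a) = 0"
  shows "cmod (zero1 n - zero2 m) =
    \<bar>2 * pi * (b2 * of_int n - b1 * of_int m) - (b1 * Arg (- d) + b2 * Arg (- a))\<bar> / \<bar>b1 * b2\<bar>"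
  unfolding zero1_minus_zero2 assms norm_divide norm_of_real by (simp add: cmod_def)

lemma not_strictly_regular_bc_irrational:
  assumes "b * c = 0" "b1 * ln (cmod d) + b2 * ln (cmod a) = 0" "b1 / b2 \<notin> \<rat>"
  shows "\<not> strictly_regular_bc b1 b2 a b c d"
proof
  assume "strictly_regular_bc b1 b2 a b c d"
  then obtain \<delta> where \<delta>: "\<delta> > 0" "finite {n. \<exists>m. cmod (zero1 n - zero2 m) < \<delta>}"
    using strictly_regular_bcD[OF assms(1)] by blast
  define D where "D = b1 * Arg (- d) + b2 * Arg (- a)"
  \<comment> \<open>Factoring out \<open>2 * pi * b1\<close> exhibits the distance as the error of
    an inhomogeneous approximation with slope \<open>b2 / b1\<close>; the quotient by
    \<open>\<bar>b1 * b2\<bar>\<close> leaves \<open>2 * pi / b2\<close>.\<close>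
  have "cmod (zero1 n - zero2 m) =
      2 * pi / b2 * \<bar>of_int n * (b2 / b1) - of_int m - D / (2 * pi * b1)\<bar>" for n m
  proof -
    have "2 * pi * (b2 * of_int n - b1 * of_int m) - D =
        2 * pi * b1 * (of_int n * (b2 / b1) - of_int m - D / (2 * pi * b1))"
      using b1 by (simp add: field_simps)
    then show ?thesis
      unfolding norm_zero1_minus_zero2[OF assms(2)] D_def[symmetric] using b1 b2
      by (simp add: abs_mult)
  qed
  then have "{n. \<exists>m. cmod (zero1 n - zero2 m) < \<delta>} =
      {n. \<exists>m. \<bar>of_int n * (b2 / b1) - of_int m - D / (2 * pi * b1)\<bar> < b2 * \<delta> / (2 * pi)}"
    using b2 by (simp only: pos_less_divide_eq pos_divide_less_eq) (simp add: field_simps)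
  moreover have "b2 / b1 \<notin> \<rat>"
    using assms(3) Rats_inverse[of "b2 / b1"] by (auto simp: field_simps)
  ultimately show False
    using infinite_inhomogeneous_approx[of "b2 / b1" "b2 * \<delta> / (2 * pi)"] \<delta> b2 by simp
qed

text \<open>In units of the gcd, distances are a fixed multiple of the distance from
  \<open>x\<close> to an integer \<open>l * n - k * m\<close>. For \<open>x\<close> outside the
  integers they are bounded below; for an integer \<open>x\<close> the progressions meet infinitely
  often.\<close>

lemma strictly_regular_bc_rational_iff:
  assumes "b * c = 0" "b1 * ln (cmod d) + b2 * ln (cmod a) = 0" "b1 / b2 \<in> \<rat>"
  shows "strictly_regular_bc b1 b2 a b c d \<longleftrightarrow>
    (b1 * Arg (- d) + b2 * Arg (- a)) / (2 * pi * real_gcd b1 b2) \<notin> \<int>"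
proof -
  define \<beta> where "\<beta> = real_gcd b1 b2"
  obtain k l :: int where kl: "coprime k l" "k \<noteq> 0" and \<beta>: "\<beta> > 0"
    and b1': "b1 = of_int k * \<beta>" and b2': "b2 = of_int l * \<beta>"
    using real_gcd_rational[of b1 b2] assms(3) b1 b2 unfolding \<beta>_def by auto
  define x where "x = (b1 * Arg (- d) + b2 * Arg (- a)) / (2 * pi * \<beta>)"
  have dist: "cmod (zero1 n - zero2 m) = 2 * pi * \<beta> / \<bar>b1 * b2\<bar> * \<bar>of_int (l * n - k * m) - x\<bar>"
    for n m
  proof -
    have "2 * pi * (b2 * of_int n - b1 * of_int m) - (b1 * Arg (- d) + b2 * Arg (- a)) =
        2 * pi * \<beta> * (of_int (l * n - k * m) - x)"
    proof -
      have "b1 * Arg (- d) + b2 * Arg (- a) = 2 * pi * \<beta> * x"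
        using \<beta> by (simp add: x_def)
      moreover have "b2 * of_int n - b1 * of_int m = \<beta> * of_int (l * n - k * m)"
        by (simp add: b1' b2' algebra_simps)
      ultimately show ?thesis by (simp only: right_diff_distrib mult.assoc)
    qed
    then show ?thesis
      unfolding norm_zero1_minus_zero2[OF assms(2)] using \<beta> by (simp add: abs_mult)
  qed
  have "strictly_regular_bc b1 b2 a b c d" if x: "x \<notin> \<int>"
  proof -
    obtain \<epsilon> where \<epsilon>: "\<epsilon> > 0" "\<And>k::int. \<bar>of_int k - x\<bar> \<ge> \<epsilon>"
      using distance_to_Ints_bounded_below[OF x] by blast
    show ?thesis
    proof (rule strictly_regular_bcI[OF assms(1)])
      show "2 * pi * \<beta> / \<bar>b1 * b2\<bar> * \<epsilon> > 0" using \<beta> \<epsilon>(1) b1 b2 by simp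
      show "cmod (zero1 n - zero2 m) \<ge> 2 * pi * \<beta> / \<bar>b1 * b2\<bar> * \<epsilon>" for n m
        unfolding dist using \<beta> by (intro mult_left_mono \<epsilon>(2)) auto
    qed
  qed
  moreover have "\<not> strictly_regular_bc b1 b2 a b c d" if x: "x \<in> \<int>"
  proof
    assume "strictly_regular_bc b1 b2 a b c d"
    then obtain \<delta> where \<delta>: "\<delta> > 0" "finite {n. \<exists>m. cmod (zero1 n - zero2 m) < \<delta>}"
      using strictly_regular_bcD[OF assms(1)] by blast
    obtain i :: int where i: "x = of_int i" using x by (auto elim: Ints_cases)
    \<comment> \<open>Bezout coefficients give one solution of \<open>l * n - k * m = i\<close>.
      Adding \<open>t\<close> times \<open>(k, l)\<close> gives further ones, with distinct
      \<open>n\<close> because \<open>k \<noteq> 0\<close>.\<close>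
    obtain r s where rs: "k * r + l * s = 1"
      using kl(1) by (metis bezout_int coprime_imp_gcd_eq_1 mult.commute)
    have "range (\<lambda>t. s * i + k * t) \<subseteq> {n. \<exists>m. cmod (zero1 n - zero2 m) < \<delta>}"
    proof safe
      fix t
      have "l * (s * i + k * t) - k * (- r * i + l * t) = (k * r + l * s) * i"
        by (simp add: algebra_simps)
      then have "cmod (zero1 (s * i + k * t) - zero2 (- r * i + l * t)) = 0"
        unfolding dist rs i by simp
      then show "\<exists>m. cmod (zero1 (s * i + k * t) - zero2 m) < \<delta>" using \<delta>(1) by metis
    qed
    then have "finite (range (\<lambda>t. s * i + k * t))" using \<delta>(2) by (rule finite_subset)
    moreover have "inj (\<lambda>t. s * i + k * t)" using kl(2) by (auto simp: inj_on_def)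
    ultimately show False using finite_imageD infinite_UNIV_int by blast
  qed
  ultimately show ?thesis unfolding x_def \<beta>_def by blast
qed

end

theorem lemma5p3:
  fixes b1 b2 :: real and a b c d :: complex
  assumes "b1 < 0" and "0 < b2"
    and "b * c = 0"
    and "regular_bc a b c d"
  shows "(b1 * ln (cmod d) + b2 * ln (cmod a) \<noteq> 0 \<longrightarrow> strictly_regular_bc b1 b2 a b c d) \<and>
    (b1 / b2 \<notin> \<rat> \<longrightarrow> strictly_regular_bc b1 b2 a b c d \<longrightarrow>
       b1 * ln (cmod d) + b2 * ln (cmod a) \<noteq> 0) \<and>
    (b1 / b2 \<in> \<rat> \<longrightarrow> b1 * ln (cmod d) + b2 * ln (cmod a) = 0 \<longrightarrow>
       (strictly_regular_bc b1 b2 a b c d \<longleftrightarrow>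
          (b1 * Arg (- d) + b2 * Arg (- a)) / (2 * pi * real_gcd b1 b2) \<notin> \<int>))"
proof -
  have "a \<noteq> 0" "d \<noteq> 0"
    using assms(3,4) by (auto simp: regular_bc_def)
  note facts = assms(1,2) this assms(3)
  show ?thesis
    using strictly_regular_bc_if_ln_neq_0[OF facts] not_strictly_regular_bc_irrational[OF facts]
      strictly_regular_bc_rational_iff[OF facts] by blast
qed

end
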